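(* Let $b\in\mathbb R$ and let $\sigma:(1,\infty)\to(0,\infty)$ be a (measurable) time-scale function. (I) The function $$\kappa(\mu,n)=\frac{e^{2(\mu-1)b}}{\mu^n\sigma(\mu)},\qquad(\mu,n)\in(1,\infty)\times\mathbb Z_+,$$ satisfies the weak invariance equation (WIE, defined in the context) with the generator $$\begin{aligned}\mathbf R\phi(\mu,n)=&\ \mu^n\sigma(\mu)\Big[\frac12\frac{\partial^2}{\partial\mu^2}\phi(\mu,n)+b\frac{\partial}{\partial\mu}\phi(\mu,n)\Big]\\&+\alpha(\mu)\Big\{\big[\phi(\mu,n+1)-\phi(\mu,n)\big]+\mu\big[\phi(\mu,n-1)-\phi(\mu,n)\big]\mathbf 1(n\ge1)\Big\}.\end{aligned}$$ (II) If $\Xi:=\sum_{n\ge0}\int_1^\infty\frac{e^{2(\mu-1)b}}{\mu^n\sigma(\mu)}\,d\mu<\infty$, then $\kappa/\Xi$ is a probability density function on $(1,\infty)\times\mathbb Z_+$ (relative to Lebesgue measure times counting measure).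
   Context: $\mathbb Z_+=\{0,1,2,\dots\}$; $\alpha(\mu)>0$ is a given time-scale function. The setting is an $M/M/1/\infty$ queue with arrival rate $1$ whose service rate $\mu$ performs a Brownian motion with drift $b$ on $(1,\infty)$ reflected at $1$; $\mathbf R$ acts on functions $\phi(\mu,n)$ that are $C^2$ in $\mu$ with $\frac{\partial}{\partial\mu}\phi(1+,n)=0$. Definition (WIE). A function $\eta:(1,\infty)\times\mathbb Z_+\to\mathbb R$ satisfies the WIE with generator $\mathbf R$ if for all $(\mu,n)\in(1,\infty)\times\mathbb Z_+$: (i) $\displaystyle\frac12\frac{\partial^2}{\partial\mu^2}\big[\mu^n\sigma(\mu)\eta(\mu,n)\big]-b\frac{\partial}{\partial\mu}\big[\mu^n\sigma(\mu)\eta(\mu,n)\big]=0$; and (ii) $\eta(\mu,n)\big[1+\mu\mathbf 1(n\ge1)\big]=\eta(\mu,n-1)\mathbf 1(n\ge1)+\mu\,\eta(\mu,n+1)$. *)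

theory Defs
  imports "HOL-Analysis.Analysis"
begin

abbreviation states :: "(real \<times> nat) set" where
  "states \<equiv> {1<..} \<times> UNIV"

text \<open>Functions on \<open>states\<close> are represented by total functions, of which only the values on
  \<open>states\<close> matter.\<close>

definition twice_differentiable_at :: "(real \<Rightarrow> real) \<Rightarrow> real \<Rightarrow> bool" where
  "twice_differentiable_at f x \<longleftrightarrow>
     f differentiable (at x) \<and> deriv f differentiable (at x)"

definition generator_domain :: "(real \<times> nat \<Rightarrow> real) set" where
  "generator_domain = {\<phi>. \<forall>n.
     (\<forall>\<mu>>1. twice_differentiable_at (\<lambda>m. \<phi> (m, n)) \<mu>) \<and>
     continuous_on {1<..} (deriv (deriv (\<lambda>m. \<phi> (m, n)))) \<and>
     (deriv (\<lambda>m. \<phi> (m, n)) \<longlongrightarrow> 0) (at_right 1)}"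

definition generator ::
  "real \<Rightarrow> (real \<Rightarrow> real) \<Rightarrow> (real \<Rightarrow> real) \<Rightarrow> (real \<times> nat \<Rightarrow> real) \<Rightarrow> (real \<times> nat \<Rightarrow> real)" where
  "generator b \<sigma> \<alpha> = (\<lambda>\<phi>\<in>generator_domain. \<lambda>(\<mu>, n)\<in>states.
     \<mu> ^ n * \<sigma> \<mu> * (1 / 2 * deriv (deriv (\<lambda>m. \<phi> (m, n))) \<mu> + b * deriv (\<lambda>m. \<phi> (m, n)) \<mu>)
     + \<alpha> \<mu> * ((\<phi> (\<mu>, n + 1) - \<phi> (\<mu>, n))
              + \<mu> * (\<phi> (\<mu>, n - 1) - \<phi> (\<mu>, n)) * of_bool (n \<ge> 1)))"

text \<open>For \<open>n = 0\<close> the truncated \<open>n - 1\<close> is harmless here and below, being multiplied by \<open>0\<close>.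

  The derivatives in the first condition are required to exist, since \<open>deriv\<close> has an
  unspecified value at points of non-differentiability.\<close>

definition WIE_equations ::
  "real \<Rightarrow> (real \<Rightarrow> real) \<Rightarrow> (real \<times> nat \<Rightarrow> real) \<Rightarrow> bool" where
  "WIE_equations b \<sigma> \<eta> \<longleftrightarrow> (\<forall>(\<mu>, n)\<in>states.
     (let f = (\<lambda>m. m ^ n * \<sigma> m * \<eta> (m, n)) in
        twice_differentiable_at f \<mu> \<and> 1 / 2 * deriv (deriv f) \<mu> - b * deriv f \<mu> = 0) \<and>
     \<eta> (\<mu>, n) * (1 + \<mu> * of_bool (n \<ge> 1))
       = \<eta> (\<mu>, n - 1) * of_bool (n \<ge> 1) + \<mu> * \<eta> (\<mu>, n + 1))"

text \<open>The weak invariance equation is attached to the operator \<open>R\<close>; its coefficients are read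
  off from \<open>R\<close>. They are determined by \<open>R\<close> on the state space, so the existential quantifier
  leaves no freedom: see \<open>WIE_generator_iff\<close> below.\<close>

definition WIE ::
  "((real \<times> nat \<Rightarrow> real) \<Rightarrow> (real \<times> nat \<Rightarrow> real)) \<Rightarrow> (real \<times> nat \<Rightarrow> real) \<Rightarrow> bool" where
  "WIE R \<eta> \<longleftrightarrow> (\<exists>b \<sigma> \<alpha>. (\<forall>\<mu>>1. \<sigma> \<mu> > 0 \<and> \<alpha> \<mu> > 0) \<and>
     R = generator b \<sigma> \<alpha> \<and> WIE_equations b \<sigma> \<eta>)"

definition kappa :: "real \<Rightarrow> (real \<Rightarrow> real) \<Rightarrow> real \<times> nat \<Rightarrow> real" where
  "kappa b \<sigma> = (\<lambda>(\<mu>, n). exp (2 * (\<mu> - 1) * b) / (\<mu> ^ n * \<sigma> \<mu>))"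

definition Xi :: "real \<Rightarrow> (real \<Rightarrow> real) \<Rightarrow> ennreal" where
  "Xi b \<sigma> = (\<Sum>n. \<integral>\<^sup>+\<mu>\<in>{1<..}. ennreal (exp (2 * (\<mu> - 1) * b) / (\<mu> ^ n * \<sigma> \<mu>)) \<partial>lborel)"

definition state_measure :: "(real \<times> nat) measure" where
  "state_measure = restrict_space lborel {1<..} \<Otimes>\<^sub>M count_space UNIV"

definition prob_density :: "'a measure \<Rightarrow> ('a \<Rightarrow> real) \<Rightarrow> bool" where
  "prob_density M f \<longleftrightarrow> f \<in> borel_measurable M \<and> (\<forall>x\<in>space M. f x \<ge> 0) \<and>
     (\<integral>\<^sup>+x. ennreal (f x) \<partial>M) = 1"

lemma WIE_equations_cong:
  assumes "\<And>\<mu>. \<mu> > 1 \<Longrightarrow> \<sigma> \<mu> = \<sigma>' \<mu>" and "WIE_equations b \<sigma> \<eta>"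
  shows "WIE_equations b \<sigma>' \<eta>"
proof -
  have "twice_differentiable_at f' \<mu> \<and> deriv f' \<mu> = deriv f \<mu>
        \<and> deriv (deriv f') \<mu> = deriv (deriv f) \<mu>"
    if eq: "\<And>x. x > 1 \<Longrightarrow> f' x = f x" and tw: "twice_differentiable_at f \<mu>" and mu: "\<mu> > 1"
    for f f' :: "real \<Rightarrow> real" and \<mu>
  proof -
    have ev: "\<forall>\<^sub>F x in nhds y. f' x = f x" if "y > 1" for y
      using eventually_nhds_in_open[of "{1<..}" y] that
      by (auto elim!: eventually_mono simp: eq)
    have d: "deriv f' y = deriv f y" if "y > 1" for y
      using ev[OF that] by (rule deriv_cong_ev) simp
    have ev2: "\<forall>\<^sub>F x in nhds \<mu>. deriv f' x = deriv f x"
      using eventually_nhds_in_open[of "{1<..}" \<mu>] mu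
      by (auto elim!: eventually_mono simp: d)
    have t: "g' differentiable (at \<mu>)"
      if ge: "\<And>x. x > 1 \<Longrightarrow> g' x = g x" and gd: "g differentiable (at \<mu>)" for g g' :: "real \<Rightarrow> real"
    proof -
      obtain D where "(g has_derivative D) (at \<mu>)"
        using gd by (auto simp: differentiable_def)
      then have "(g' has_derivative D) (at \<mu>)"
        by (rule has_derivative_transform_within_open[of _ _ _ _ "{1<..}"])
           (use mu ge in auto)
      then show ?thesis by (auto simp: differentiable_def)
    qed
    show ?thesis
      using tw t[of f' f] t[of "deriv f'" "deriv f"] eq d mu deriv_cong_ev[OF ev2 refl]
      by (auto simp: twice_differentiable_at_def)
  qed
  note * = this
  show ?thesis
    unfolding WIE_equations_def Let_def
  proof (clarify, goal_cases)
    case (1 \<mu> n)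
    let ?f = "\<lambda>m. m ^ n * \<sigma> m * \<eta> (m, n)" and ?f' = "\<lambda>m. m ^ n * \<sigma>' m * \<eta> (m, n)"
    have mu: "\<mu> > 1" using 1 by simp
    have w: "twice_differentiable_at ?f \<mu>" "1 / 2 * deriv (deriv ?f) \<mu> - b * deriv ?f \<mu> = 0"
      "\<eta> (\<mu>, n) * (1 + \<mu> * of_bool (n \<ge> 1))
       = \<eta> (\<mu>, n - 1) * of_bool (n \<ge> 1) + \<mu> * \<eta> (\<mu>, n + 1)"
      using assms(2) mu unfolding WIE_equations_def Let_def by auto
    have "twice_differentiable_at ?f' \<mu> \<and> deriv ?f' \<mu> = deriv ?f \<mu>
        \<and> deriv (deriv ?f') \<mu> = deriv (deriv ?f) \<mu>"
      by (rule *) (use mu assms(1) w(1) in auto)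
    then show ?case using w by simp
  qed
qed

lemma generator_power:
  assumes "\<mu> > 1" and "k \<ge> 2"
  shows "(\<lambda>(m, n). (m - 1) ^ k) \<in> generator_domain"
    and "generator b \<sigma> \<alpha> (\<lambda>(m, n). (m - 1) ^ k) (\<mu>, 0)
         = \<sigma> \<mu> * (1 / 2 * real k * real (k - 1) * (\<mu> - 1) ^ (k - 2)
                    + b * real k * (\<mu> - 1) ^ (k - 1))"
proof -
  have g: "((\<lambda>m::real. (m - 1) ^ j) has_real_derivative real j * (x - 1) ^ (j - 1)) (at x)" for x j
    by (auto intro!: derivative_eq_intros)
  have d1: "deriv (\<lambda>m::real. (m - 1) ^ k) = (\<lambda>x. real k * (x - 1) ^ (k - 1))"
    using DERIV_imp_deriv[OF g] by blast
  have g2: "((\<lambda>m::real. real k * (m - 1) ^ (k - 1)) has_real_derivative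
              real k * (real (k - 1) * (x - 1) ^ (k - 2))) (at x)" for x
    using DERIV_cmult[OF g[of "k - 1" x], of "real k"] by (simp add: numeral_2_eq_2)
  have d2: "deriv (\<lambda>x::real. real k * (x - 1) ^ (k - 1))
            = (\<lambda>x. real k * (real (k - 1) * (x - 1) ^ (k - 2)))"
    using DERIV_imp_deriv[OF g2] by blast
  have "((\<lambda>x::real. real k * (x - 1) ^ (k - 1)) \<longlongrightarrow> real k * (1 - 1) ^ (k - 1)) (at_right 1)"
    by (intro tendsto_intros)
  then have l: "((\<lambda>x::real. real k * (x - 1) ^ (k - 1)) \<longlongrightarrow> 0) (at_right 1)"
    using assms(2) by (simp add: power_0_left split: if_splits)
  have c: "continuous_on {1<..} (\<lambda>x::real. real k * (real (k - 1) * (x - 1) ^ (k - 2)))"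
    by (intro continuous_intros)
  show dom: "(\<lambda>(m, n). (m - 1) ^ k) \<in> generator_domain"
    unfolding generator_domain_def twice_differentiable_at_def
    using g g2 l c by (auto simp: d1 d2[unfolded One_nat_def] real_differentiable_def)
  show "generator b \<sigma> \<alpha> (\<lambda>(m, n). (m - 1) ^ k) (\<mu>, 0)
         = \<sigma> \<mu> * (1 / 2 * real k * real (k - 1) * (\<mu> - 1) ^ (k - 2)
                    + b * real k * (\<mu> - 1) ^ (k - 1))"
    using dom assms by (simp add: generator_def d1 d2[unfolded One_nat_def])
qed

lemma generator_inject:
  assumes "generator b \<sigma> \<alpha> = generator b' \<sigma>' \<alpha>'" and pos: "\<And>\<mu>. \<mu> > 1 \<Longrightarrow> \<sigma> \<mu> > 0"
  shows "b = b'" and "\<And>\<mu>. \<mu> > 1 \<Longrightarrow> \<sigma> \<mu> = \<sigma>' \<mu>"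
proof -
  have e2: "\<sigma> \<mu> * (1 + 2 * b * (\<mu> - 1)) = \<sigma>' \<mu> * (1 + 2 * b' * (\<mu> - 1))" if "\<mu> > 1" for \<mu>
    using generator_power(2)[of \<mu> 2 b \<sigma> \<alpha>] generator_power(2)[of \<mu> 2 b' \<sigma>' \<alpha>'] that assms(1)
    by (simp add: algebra_simps)
  have e3: "\<sigma> \<mu> * (1 + b * (\<mu> - 1)) = \<sigma>' \<mu> * (1 + b' * (\<mu> - 1))" if "\<mu> > 1" for \<mu>
  proof -
    have "(3 * (\<mu> - 1)) * (\<sigma> \<mu> * (1 + b * (\<mu> - 1))) = (3 * (\<mu> - 1)) * (\<sigma>' \<mu> * (1 + b' * (\<mu> - 1)))"
      using generator_power(2)[of \<mu> 3 b \<sigma> \<alpha>] generator_power(2)[of \<mu> 3 b' \<sigma>' \<alpha>'] that assms(1)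
      by (simp add: algebra_simps power2_eq_square)
    then show ?thesis using that by simp
  qed
  show s: "\<sigma> \<mu> = \<sigma>' \<mu>" if "\<mu> > 1" for \<mu>
    using e2[OF that] e3[OF that] by (simp add: algebra_simps)
  show "b = b'"
    using e3[of 2] s[of 2] pos[of 2] by simp
qed

lemma WIE_generator_iff:
  assumes "\<And>\<mu>. \<mu> > 1 \<Longrightarrow> \<sigma> \<mu> > 0" and "\<And>\<mu>. \<mu> > 1 \<Longrightarrow> \<alpha> \<mu> > 0"
  shows "WIE (generator b \<sigma> \<alpha>) \<eta> \<longleftrightarrow> WIE_equations b \<sigma> \<eta>"
proof
  assume "WIE (generator b \<sigma> \<alpha>) \<eta>"
  then obtain b' \<sigma>' \<alpha>' where *: "generator b \<sigma> \<alpha> = generator b' \<sigma>' \<alpha>'" "WIE_equations b' \<sigma>' \<eta>"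
    by (auto simp: WIE_def)
  show "WIE_equations b \<sigma> \<eta>"
    using generator_inject[OF *(1) assms(1)] *(2) WIE_equations_cong[of \<sigma>' \<sigma> b' \<eta>] by simp
next
  assume "WIE_equations b \<sigma> \<eta>"
  then show "WIE (generator b \<sigma> \<alpha>) \<eta>"
    using assms unfolding WIE_def by blast
qed

end

theory Submission
  imports Defs
begin

text \<open>The factor \<mu>^n \<sigma>(\<mu>) in the first equation cancels the denominator of
  \<open>kappa\<close>, leaving exp(2b(\<mu> - 1)) for every n. This solves f''/2 - b f' = 0 because
  2b is a root of c^2/2 - b c. For fixed \<mu>, \<open>kappa\<close> is geometric in n with ratio
  1/\<mu>, so \<mu> \<kappa>(\<mu>, n+1) = \<kappa>(\<mu>, n): this is detailed balance for the
  M/M/1 queue with service rate \<mu>, and it gives the second equation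
  (\<open>WIE_equations_kappa\<close>).

  For the density, Tonelli identifies the total mass of \<open>kappa\<close> with \<open>Xi\<close>
  (\<open>nn_integral_kappa\<close>). Positivity of \<open>kappa\<close> makes this mass nonzero
  (\<open>Xi_nonzero\<close>), so when it is finite one may divide by it.\<close>

lemma twice_derivative_exp_affine_on_open:
  fixes f :: "real \<Rightarrow> real"
  assumes "open S" and "x \<in> S" and eq: "\<And>y. y \<in> S \<Longrightarrow> f y = exp (c * (y - a))"
  shows "twice_differentiable_at f x" and "deriv f x = c * exp (c * (x - a))"
    and "deriv (deriv f) x = c\<^sup>2 * exp (c * (x - a))"
proof -
  \<comment> \<open>Differentiation is local, so agreement with the exponential on the open set
    \<open>S\<close> suffices; below, \<sigma> is arbitrary outside (1, \<infinity>). The first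
    derivative is computed on all of \<open>S\<close> so that it can be differentiated
    again.\<close>
  have d1: "(f has_real_derivative c * exp (c * (y - a))) (at y)" if "y \<in> S" for y
    by (rule has_field_derivative_transform_within_open[where S = S and f = "\<lambda>y. exp (c * (y - a))"])
       (use assms(1) that eq in \<open>auto intro!: derivative_eq_intros\<close>)
  have e1: "deriv f y = c * exp (c * (y - a))" if "y \<in> S" for y
    using d1[OF that] by (rule DERIV_imp_deriv)
  have d2: "(deriv f has_real_derivative c\<^sup>2 * exp (c * (x - a))) (at x)"
    by (rule has_field_derivative_transform_within_open[where S = S and f = "\<lambda>y. c * exp (c * (y - a))"])
       (use assms(1,2) e1 in \<open>auto intro!: derivative_eq_intros simp: power2_eq_square\<close>)
  show "twice_differentiable_at f x"
    using d1[OF assms(2)] d2 by (auto simp: twice_differentiable_at_def real_differentiable_def)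
  show "deriv f x = c * exp (c * (x - a))" using assms(2) by (rule e1)
  show "deriv (deriv f) x = c\<^sup>2 * exp (c * (x - a))" using d2 by (rule DERIV_imp_deriv)
qed

lemma WIE_equations_kappa:
  assumes pos: "\<And>\<mu>. \<mu> > 1 \<Longrightarrow> \<sigma> \<mu> > 0"
  shows "WIE_equations b \<sigma> (kappa b \<sigma>)"
  unfolding WIE_equations_def Let_def
proof (clarify, goal_cases)
  case (1 \<mu> n)
  then have mu: "\<mu> > 1" by simp
  let ?f = "\<lambda>m. m ^ n * \<sigma> m * kappa b \<sigma> (m, n)"
  have f: "?f y = exp ((2 * b) * (y - 1))" if "y \<in> {1<..}" for y
    using pos[of y] that by (simp add: kappa_def mult_ac)
  note d = twice_derivative_exp_affine_on_open[of "{1<..}" \<mu> ?f, OF _ _ f]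
  have "kappa b \<sigma> (\<mu>, n) * (1 + \<mu> * of_bool (n \<ge> 1))
      = kappa b \<sigma> (\<mu>, n - 1) * of_bool (n \<ge> 1) + \<mu> * kappa b \<sigma> (\<mu>, n + 1)"
    \<comment> \<open>For n = 0 this is the balance between levels 0 and 1; for n \<ge> 1 it is the
      sum of the balances across n-1, n and across n, n+1.\<close>
    using pos[OF mu] mu by (cases n) (auto simp: kappa_def field_simps)
  then show ?case
    using d mu by (simp add: power2_eq_square)
qed

lemma kappa_pos:
  assumes "\<And>\<mu>. \<mu> > 1 \<Longrightarrow> \<sigma> \<mu> > 0" and "x \<in> states"
  shows "kappa b \<sigma> x > 0"
proof -
  obtain \<mu> n where x: "x = (\<mu>, n)" by (cases x)
  then have mu: "\<mu> > 1" using assms(2) by simp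
  then have "\<mu> ^ n * \<sigma> \<mu> > 0" using assms(1) by (intro mult_pos_pos zero_less_power) auto
  then show ?thesis by (simp add: kappa_def x)
qed

lemma measurable_kappa:
  assumes "\<sigma> \<in> borel_measurable (restrict_space borel {1<..})"
  shows "kappa b \<sigma> \<in> borel_measurable state_measure"
proof -
  \<comment> \<open>The hypothesis on \<sigma> concerns \<open>borel\<close>, while
    \<open>state_measure\<close> is built from \<open>lborel\<close>; only the sigma-algebra matters
    here.\<close>
  have sets: "sets (restrict_space lborel {1<..}) = sets (restrict_space borel {1<..})"
    by (rule sets_restrict_space_cong) simp
  have fst_m: "fst \<in> measurable state_measure (restrict_space borel {1<..})"
    unfolding state_measure_def using measurable_fst measurable_cong_sets[OF refl sets] by blast
  have id_m: "(\<lambda>x. x) \<in> borel_measurable (restrict_space borel {1::real<..})"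
    by (rule measurable_restrict_space1) simp
  have [measurable]: "(\<lambda>x. \<sigma> (fst x)) \<in> borel_measurable state_measure"
    "fst \<in> borel_measurable state_measure"
    using measurable_compose[OF fst_m assms] measurable_compose[OF fst_m id_m] by simp_all
  have [measurable]: "snd \<in> measurable state_measure (count_space UNIV)"
    unfolding state_measure_def by simp
  have "(\<lambda>x. exp (2 * (fst x - 1) * b) / (fst x ^ snd x * \<sigma> (fst x)))
      \<in> borel_measurable state_measure"
    by measurable
  then show ?thesis by (simp add: kappa_def case_prod_beta)
qed

lemma nn_integral_kappa:
  assumes "\<sigma> \<in> borel_measurable (restrict_space borel {1<..})"
  shows "(\<integral>\<^sup>+x. ennreal (kappa b \<sigma> x) \<partial>state_measure) = Xi b \<sigma>"
proof -
  let ?M = "restrict_space lborel {1::real<..}" and ?N = "count_space (UNIV :: nat set)"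
  interpret M: sigma_finite_measure ?M
    by (rule sigma_finite_measure_restrict_space) (auto intro: lborel.sigma_finite_measure_axioms)
  interpret N: sigma_finite_measure ?N
    by (rule sigma_finite_measure_count_space_countable) simp
  interpret pair_sigma_finite ?M ?N ..
  have "(\<integral>\<^sup>+x. ennreal (kappa b \<sigma> x) \<partial>state_measure)
      = (\<integral>\<^sup>+n. \<integral>\<^sup>+\<mu>. ennreal (kappa b \<sigma> (\<mu>, n)) \<partial>?M \<partial>?N)"
    \<comment> \<open>Tonelli with \<mu> integrated first: the outer integral against counting
      measure is then the series in \<open>Xi\<close>.\<close>
    using measurable_kappa[OF assms]
    by (subst nn_integral_snd) (auto simp: state_measure_def)
  also have "\<dots> = Xi b \<sigma>"
    by (simp add: Xi_def kappa_def nn_integral_count_space_nat nn_integral_restrict_space)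
  finally show ?thesis .
qed

text \<open>The term n = 0 alone is nonzero: a nonnegative function with zero integral vanishes
  almost everywhere, but \<open>kappa\<close> is strictly positive on a set of positive
  length.\<close>

lemma Xi_nonzero:
  assumes "\<And>\<mu>. \<mu> > 1 \<Longrightarrow> \<sigma> \<mu> > 0"
    and "\<sigma> \<in> borel_measurable (restrict_space borel {1<..})"
  shows "Xi b \<sigma> \<noteq> 0"
proof
  let ?g = "\<lambda>\<mu>. ennreal (kappa b \<sigma> (\<mu>, 0))"
  let ?M = "restrict_space lborel {1::real<..}"
  assume "Xi b \<sigma> = 0"
  then have "(\<integral>\<^sup>+\<mu>\<in>{1<..}. ennreal (exp (2 * (\<mu> - 1) * b) / (\<mu> ^ n * \<sigma> \<mu>)) \<partial>lborel) = 0" for n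
    unfolding Xi_def by (subst (asm) suminf_eq_zero_iff) auto
  from this[of 0] have "(\<integral>\<^sup>+\<mu>. ?g \<mu> \<partial>?M) = 0"
    by (simp add: kappa_def nn_integral_restrict_space)
  moreover have "?g \<in> borel_measurable ?M"
  proof -
    have "(\<lambda>\<mu>. (\<mu>, 0)) \<in> measurable ?M state_measure"
      unfolding state_measure_def by (intro measurable_Pair) auto
    from measurable_compose[OF this measurable_kappa[OF assms(2)]]
    show ?thesis by (rule measurable_compose[OF _ measurable_ennreal])
  qed
  ultimately have "AE \<mu> in ?M. ?g \<mu> = 0"
    by (simp add: nn_integral_0_iff_AE)
  then have "AE \<mu> in lborel. \<mu> \<in> {1::real<..} \<longrightarrow> ?g \<mu> = 0"
    by (simp add: AE_restrict_space_iff)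
  \<comment> \<open>Any subset of (1, \<infinity>) of positive measure would do; this interval has
    length 1.\<close>
  then have "AE \<mu> in lborel. \<mu> \<notin> {1::real<..2}"
  proof eventually_elim
    case (elim \<mu>)
    then show ?case using kappa_pos[of \<sigma> "(\<mu>, 0)" b, OF assms(1)] by auto
  qed
  then have "emeasure lborel {1::real<..2} = 0"
    by (subst (asm) AE_iff_measurable[of "{1<..2}"]) auto
  then show False by simp
qed

theorem theorem5p2:
  fixes b :: real and \<sigma> \<alpha> :: "real \<Rightarrow> real"
  assumes "\<forall>\<mu>>1. \<sigma> \<mu> > 0"
    and "\<sigma> \<in> borel_measurable (restrict_space borel {1<..})"
    and "\<forall>\<mu>>1. \<alpha> \<mu> > 0"
  shows "WIE (generator b \<sigma> \<alpha>) (kappa b \<sigma>) \<and>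
    (Xi b \<sigma> < \<infinity> \<longrightarrow>
      prob_density state_measure (\<lambda>x. kappa b \<sigma> x / enn2real (Xi b \<sigma>)))"
proof (intro conjI impI)
  have pos: "\<And>\<mu>. \<mu> > 1 \<Longrightarrow> \<sigma> \<mu> > 0" using assms(1) by simp
  show "WIE (generator b \<sigma> \<alpha>) (kappa b \<sigma>)"
    using assms by (simp add: WIE_generator_iff WIE_equations_kappa)
  assume fin: "Xi b \<sigma> < \<infinity>"
  define z where "z = enn2real (Xi b \<sigma>)"
  \<comment> \<open>\<open>enn2real\<close> sends both 0 and \<infinity> to 0, so positivity of
    \<open>z\<close> uses both that \<open>Xi\<close> is finite and that it is nonzero.\<close>
  have z: "z > 0" "Xi b \<sigma> = ennreal z"
    using fin Xi_nonzero[OF pos assms(2), of b]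
    by (auto simp: z_def enn2real_positive_iff zero_less_iff_neq_zero)
  have space: "space state_measure = states"
    by (simp add: state_measure_def space_pair_measure)
  have "(\<integral>\<^sup>+x. ennreal (kappa b \<sigma> x / z) \<partial>state_measure)
      = (\<integral>\<^sup>+x. ennreal (kappa b \<sigma> x) / ennreal z \<partial>state_measure)"
    using z(1) kappa_pos[OF pos, THEN less_imp_le] by (intro nn_integral_cong) (auto simp: space divide_ennreal)
  also have "\<dots> = Xi b \<sigma> / ennreal z"
    using measurable_kappa[OF assms(2), of b]
    by (simp add: nn_integral_divide nn_integral_kappa[OF assms(2)])
  also have "\<dots> = 1"
    using z by (simp add: divide_ennreal)
  finally show "prob_density state_measure (\<lambda>x. kappa b \<sigma> x / enn2real (Xi b \<sigma>))"
    using measurable_kappa[OF assms(2), of b] kappa_pos[OF pos, THEN less_imp_le] z(1)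
    unfolding prob_density_def z_def[symmetric] space by auto
qed

end
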